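(* Let $p>\theta>0$ and let $dm_\theta=g^{-\theta}\,dx$ on $\mathbb{R}$, where $g(x)=2^{1/4}e^{-\pi x^2}$. There exist a constant $C(p,\theta)>0$ depending only on $p$ and $\theta$ and a sequence of nonnegative functions $\{h_k\}_{k\ge1}$ in $L^p(dm_\theta)$ such that $\|h_k\|_2=1$ for all $k$, $\delta_{\mathrm{BH}}(h_k)\to0$ and $\|h_k\|_{L^p(dm_\theta)}\to\infty$ as $k\to\infty$, and $$\liminf_{k\to\infty}\frac{\mathrm{dist}_{L^p(dm_\theta)}(h_k,\mathfrak{G})}{\|h_k\|_{L^p(dm_\theta)}}\ge C(p,\theta)>0.$$
   Context: All functions are on $\mathbb{R}$, and $\|\cdot\|_2$ is the $L^2$ norm with respect to Lebesgue measure. The Shannon entropy of a nonnegative function $\rho$ is $S(\rho)=-\int_{\mathbb{R}}\rho\log\rho\,dx$. For a nonnegative $h$ with $\|h\|_2=1$, the deficit of the Beckner–Hirschman inequality is $$\delta_{\mathrm{BH}}(h)=S(|h|^2)+S(|\widehat h|^2)-(1-\log2)\ge0,\qquad \widehat h(\xi)=\int_{\mathbb{R}}e^{-2\pi i x\xi}h(x)\,dx.$$ The set of nonnegative $L^2$-normalized optimizers (those $h$ with $\delta_{\mathrm{BH}}(h)=0$) is $$\mathfrak{G}=\left\{G_{a,r}(x)=\left(\tfrac{2a}{\pi}\right)^{1/4}e^{-a(x-r)^2}:a>0,\ r\in\mathbb{R}\right\}.$$ For a measure $\mu$ on $\mathbb{R}$ and $p>0$, $\mathrm{dist}_{L^p(d\mu)}(h,\mathfrak{G})=\inf_{u\in\mathfrak{G}}\|h-u\|_{L^p(d\mu)}=\inf_{a>0,\,r\in\mathbb{R}}\|h-G_{a,r}\|_{L^p(d\mu)}$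 (with the value $\|h-G_{a,r}\|_{L^p(d\mu)}=\infty$ allowed when $G_{a,r}\notin L^p(d\mu)$). For $0<p<1$, $\|u\|_{L^p(d\mu)}$ means $\left(\int|u|^p\,d\mu\right)^{1/p}$. *)

theory Defs
  imports "HOL-Analysis.Analysis"
begin

text \<open>
  The \<open>L^p\<close> (quasi-)norm, with value \<open>\<infinity>\<close> outside \<open>L^p\<close>; only used for \<open>p > 0\<close>.
  The case distinction supplies the power \<open>1/p\<close> on \<^typ>\<open>ennreal\<close>.
\<close>

definition Lp_norm :: "real \<Rightarrow> real measure \<Rightarrow> (real \<Rightarrow> real) \<Rightarrow> ennreal" where
  "Lp_norm p M u =
     (let I = (\<integral>\<^sup>+ x. ennreal (\<bar>u x\<bar> powr p) \<partial>M)
      in if I = \<infinity> then \<infinity> else ennreal (enn2real I powr (1 / p)))"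

definition Lp :: "real \<Rightarrow> real measure \<Rightarrow> (real \<Rightarrow> real) set" where
  "Lp p M = {u. u \<in> borel_measurable M \<and> Lp_norm p M u < \<infinity>}"

text \<open>
  The entropy \<open>- \<integral> \<rho> log \<rho>\<close> as the extended integral, positive part minus negative part
  (\<^const>\<open>ennreal\<close> truncates negative reals to 0), with \<open>0 log 0 = 0\<close>.
  In \<^typ>\<open>ereal\<close>, \<open>\<infinity> - \<infinity> = \<infinity>\<close> and \<open>\<infinity> + (-\<infinity>) = \<infinity>\<close>, so an undefined entropy has value
  \<open>\<infinity>\<close>, and so has any sum containing it: a finite deficit below means that both integrals
  converge absolutely.
\<close>

definition entropy :: "(real \<Rightarrow> real) \<Rightarrow> ereal" where
  "entropy \<rho> =
     enn2ereal (\<integral>\<^sup>+ x. ennreal (- (\<rho> x * ln (\<rho> x))) \<partial>lborel)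
     - enn2ereal (\<integral>\<^sup>+ x. ennreal (\<rho> x * ln (\<rho> x)) \<partial>lborel)"

text \<open>
  The integral is a Bochner integral, hence meaningful for integrable \<open>h\<close> only. This is enough:
  for \<open>p > \<theta> > 0\<close> every function in \<open>L^2 \<inter> L^p(dm_\<theta>)\<close> is integrable, by Hoelder's inequality
  if \<open>p > 1\<close>, trivially if \<open>p = 1\<close>, and by interpolation between \<open>L^p\<close> and \<open>L^2\<close> if \<open>p < 1\<close>
  (the density of \<open>m_\<theta>\<close> is bounded below by a positive constant).
\<close>

definition fourier :: "(real \<Rightarrow> real) \<Rightarrow> real \<Rightarrow> complex" where
  "fourier h \<xi> =
     (\<integral>x. exp (- 2 * of_real pi * \<i> * of_real x * of_real \<xi>) * of_real (h x) \<partial>lborel)"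

definition delta_BH :: "(real \<Rightarrow> real) \<Rightarrow> ereal" where
  "delta_BH h =
     entropy (\<lambda>x. \<bar>h x\<bar>\<^sup>2) + entropy (\<lambda>\<xi>. (cmod (fourier h \<xi>))\<^sup>2) - ereal (1 - ln 2)"

definition gauss :: "real \<Rightarrow> real \<Rightarrow> real \<Rightarrow> real" where
  "gauss a r x = (2 * a / pi) powr (1 / 4) * exp (- a * (x - r)\<^sup>2)"

definition gaussians :: "(real \<Rightarrow> real) set" where
  "gaussians = {gauss a r | a r. a > 0}"

definition Lp_dist :: "real \<Rightarrow> real measure \<Rightarrow> (real \<Rightarrow> real) \<Rightarrow> (real \<Rightarrow> real) set \<Rightarrow> ennreal" where
  "Lp_dist p M h G = (INF u\<in>G. Lp_norm p M (\<lambda>x. h x - u x))"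

definition std_gauss :: "real \<Rightarrow> real" where
  "std_gauss x = 2 powr (1 / 4) * exp (- pi * x\<^sup>2)"

definition m_theta :: "real \<Rightarrow> real measure" where
  "m_theta \<theta> = density lborel (\<lambda>x. ennreal (std_gauss x powr (- \<theta>)))"

end

theory Submission
  imports Defs "HOL-Probability.Characteristic_Functions" "HOL-Real_Asymp.Real_Asymp"
begin

text \<open>
  Take \<open>h\<^sub>k\<close> to be the normalisation of \<open>g + exp (-k) (g(\<cdot> - k) + g(\<cdot> + k))\<close>. Its Fourier transform is
  \<open>g\<close> times the bounded factor \<open>1 + 2 exp (-k) cos (2 \<pi> k \<xi>)\<close>, again up to normalisation. Both functions
  converge pointwise to \<open>g\<close> and are dominated by a fixed multiple of \<open>exp (- \<bar>x\<bar>)\<close>, uniformly in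
  \<open>k\<close>, so both entropies converge to that of \<open>g\<^sup>2\<close> and the deficit tends to 0.

  After multiplication by the \<open>p\<close>-th root of the weight, the two small bumps become bumps of a fixed
  Gaussian shape at distance \<open>X = k p / (p - \<theta>)\<close> from the origin on either side, of height growing
  like \<open>exp (\<pi> \<theta> k\<^sup>2 / (p - \<theta>) - k)\<close>, which is therefore the order of the weighted norm. A weighted
  element of \<open>\<G>\<close> is the exponential of a quadratic polynomial. If it is large somewhere on both
  bumps, it is large either everywhere between them (if the polynomial is concave) or everywhere to
  the right of them (if it is convex), where \<open>h\<^sub>k\<close> is small. In each case it misses \<open>h\<^sub>k\<close> by a
  fixed fraction of the height on an interval of length 1.
\<close>

section \<open>Entropies of dominated sequences\<close>

lemma integrable_exp_minus_abs: "integrable lborel (\<lambda>x::real. exp (- \<bar>x\<bar>))"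
proof -
  have "has_bochner_integral lborel (\<lambda>x::real. indicator {0..} x *\<^sub>R exp (- \<bar>x\<bar>)) 1"
  proof (rule has_bochner_integral_nn_integral)
    have "(\<integral>\<^sup>+ x. ennreal (indicator {0..} x *\<^sub>R exp (- \<bar>x\<bar>)) \<partial>lborel)
        = (\<integral>\<^sup>+ x. ennreal (x ^ 0 * exp (- x)) * indicator {0..} x \<partial>lborel)"
      by (intro nn_integral_cong) (auto simp: indicator_def)
    then show "(\<integral>\<^sup>+ x. ennreal (indicator {0..} x *\<^sub>R exp (- \<bar>x\<bar>)) \<partial>lborel) = ennreal 1"
      using nn_intergal_power_times_exp_Ici[of 0] by simp
  qed auto
  from has_bochner_integral_even_function[OF this] show ?thesis
    by (auto simp: has_bochner_integral_iff)
qed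

text \<open>Integrability makes the positive and the negative part finite, so the
  \<open>ereal\<close> difference never meets the convention for \<infinity> - \<infinity>.\<close>

lemma entropy_eq_integral:
  assumes "integrable lborel (\<lambda>x. \<rho> x * ln (\<rho> x))"
  shows "entropy \<rho> = ereal (- (\<integral>x. \<rho> x * ln (\<rho> x) \<partial>lborel))"
proof -
  have "(\<integral>\<^sup>+ x. ennreal (\<rho> x * ln (\<rho> x)) \<partial>lborel) \<noteq> \<infinity>"
    "(\<integral>\<^sup>+ x. ennreal (- (\<rho> x * ln (\<rho> x))) \<partial>lborel) \<noteq> \<infinity>"
    using assms by (auto simp: real_integrable_def)
  then show ?thesis
    unfolding entropy_def real_lebesgue_integral_def[OF assms]
    by (cases "\<integral>\<^sup>+ x. ennreal (\<rho> x * ln (\<rho> x)) \<partial>lborel";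
        cases "\<integral>\<^sup>+ x. ennreal (- (\<rho> x * ln (\<rho> x))) \<partial>lborel")
      (auto simp: enn2ereal_ennreal)
qed

text \<open>Both regimes come from \<open>ln s \<le> s - 1\<close>: with \<open>s = t\<close> for
  \<open>1 \<le> t\<close>, and with \<open>s = 1 / t\<close> for \<open>t < 1\<close>, where the
  bound is 1. The hypothesis \<open>1 \<le> C\<close> lets \<open>C\<^sup>2\<close> cover
  both.\<close>

lemma abs_mult_ln_le:
  fixes t C :: real
  assumes "0 \<le> t" "t \<le> C" "1 \<le> C"
  shows "\<bar>t * ln t\<bar> \<le> C\<^sup>2"
proof (cases "t = 0 \<or> 1 \<le> t")
  case True
  then show ?thesis
  proof
    assume t: "1 \<le> t"
    then have "t * ln t \<le> t * t"
      using ln_le_minus_one[of t] by (intro mult_left_mono) auto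
    also have "\<dots> \<le> C\<^sup>2"
      using assms t by (auto simp: power2_eq_square intro: mult_mono)
    finally show ?thesis
      using t by (simp add: abs_of_nonneg)
  qed simp
next
  case False
  then have t: "0 < t" "t < 1"
    using assms by auto
  have "ln (1 / t) \<le> 1 / t - 1"
    using t by (intro ln_le_minus_one) auto
  then have "t * (- ln t) \<le> t * (1 / t - 1)"
    using t by (intro mult_left_mono) (auto simp: ln_div)
  also have "\<dots> \<le> 1"
    using t by (simp add: field_simps)
  also have "1 \<le> C\<^sup>2"
    using assms by (simp add: one_le_power)
  finally show ?thesis
    using t by (simp add: abs_mult abs_of_neg)
qed

text \<open>Dominated convergence, with the integrand split as \<open>2 * h * (h * ln h)\<close>:
  the first factor carries the exponential decay, the second is bounded by
  \<open>abs_mult_ln_le\<close>. Positivity of the limit makes the logarithm continuous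
  there.\<close>

lemma entropy_square_tendsto:
  fixes h :: "nat \<Rightarrow> real \<Rightarrow> real" and f :: "real \<Rightarrow> real"
  assumes meas [measurable]: "\<And>k. h k \<in> borel_measurable borel" "f \<in> borel_measurable borel"
    and nonneg: "\<And>k x. 0 \<le> h k x"
    and bound: "\<And>k x. h k x \<le> C * exp (- \<bar>x\<bar>)"
    and lim: "\<And>x. (\<lambda>k. h k x) \<longlonglongrightarrow> f x" and pos: "\<And>x. 0 < f x"
  shows "(\<lambda>k. entropy (\<lambda>x. (h k x)\<^sup>2))
    \<longlonglongrightarrow> ereal (- (\<integral>x. (f x)\<^sup>2 * ln ((f x)\<^sup>2) \<partial>lborel))"
proof -
  \<comment> \<open>The maximum with 1 supplies the hypothesis \<open>1 \<le> C\<close> of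
    \<open>abs_mult_ln_le\<close>.\<close>
  define D where "D = max C 1"
  have hD: "h k x \<le> D * exp (- \<bar>x\<bar>)" for k x
    using bound[of k x] by (rule order_trans) (auto simp: D_def)
  have hD': "h k x \<le> D" for k x
  proof -
    have "D * exp (- \<bar>x\<bar>) \<le> D * 1"
      by (intro mult_left_mono) (auto simp: D_def)
    then show ?thesis
      using hD[of k x] by simp
  qed
  let ?w = "\<lambda>x. 2 * D ^ 3 * exp (- \<bar>x\<bar>)"
  have dom: "norm ((h k x)\<^sup>2 * ln ((h k x)\<^sup>2)) \<le> ?w x" for k x
  proof -
    have "norm ((h k x)\<^sup>2 * ln ((h k x)\<^sup>2)) = 2 * (h k x * \<bar>h k x * ln (h k x)\<bar>)"
    proof (cases "h k x = 0")
      case False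
      then have "0 < h k x"
        using nonneg[of k x] by simp
      then show ?thesis
        by (simp add: ln_realpow abs_mult) (simp add: power2_eq_square)
    qed simp
    also have "\<dots> \<le> 2 * ((D * exp (- \<bar>x\<bar>)) * D\<^sup>2)"
      using abs_mult_ln_le[OF nonneg[of k x] hD'[of k x]] hD[of k x] nonneg[of k x]
      by (intro mult_left_mono mult_mono) (auto simp: D_def)
    finally show ?thesis
      by (simp add: power3_eq_cube power2_eq_square mult_ac)
  qed
  have w: "integrable lborel ?w"
    using integrable_exp_minus_abs by simp
  have lim2: "(\<lambda>k. (h k x)\<^sup>2 * ln ((h k x)\<^sup>2)) \<longlonglongrightarrow> (f x)\<^sup>2 * ln ((f x)\<^sup>2)" for x
    using pos[of x] by (intro tendsto_intros lim) auto
  have meas2: "(\<lambda>x. (h k x)\<^sup>2 * ln ((h k x)\<^sup>2)) \<in> borel_measurable lborel" for k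
    by measurable
  have dom': "norm ((h k x)\<^sup>2 * ln ((h k x)\<^sup>2)) \<le> norm (?w x)" for k x
    using order_trans[OF dom abs_ge_self] unfolding real_norm_def .
  have int: "integrable lborel (\<lambda>x. (h k x)\<^sup>2 * ln ((h k x)\<^sup>2))" for k
    by (rule Bochner_Integration.integrable_bound[OF w meas2 AE_I2[OF dom']])
  have "(\<lambda>k. \<integral>x. (h k x)\<^sup>2 * ln ((h k x)\<^sup>2) \<partial>lborel)
      \<longlonglongrightarrow> (\<integral>x. (f x)\<^sup>2 * ln ((f x)\<^sup>2) \<partial>lborel)"
    by (rule integral_dominated_convergence[OF _ meas2 w AE_I2[OF lim2] AE_I2[OF dom]]) measurable
  then show ?thesis
    unfolding entropy_eq_integral[OF int] by (intro tendsto_ereal tendsto_minus)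
qed

section \<open>The standard Gaussian: normalisation, entropy and Fourier transform\<close>

lemma std_gauss_pos: "0 < std_gauss x"
  by (simp add: std_gauss_def)

lemma borel_measurable_std_gauss [measurable]: "std_gauss \<in> borel_measurable borel"
  unfolding std_gauss_def by measurable

text \<open>The variance is \<open>1 / (4 * pi)\<close>. Total mass and second moment then follow
  from the moments of the normal distribution.\<close>

lemma std_gauss_square: "(std_gauss x)\<^sup>2 = normal_density 0 (1 / (2 * sqrt pi)) x"
proof -
  have "(2 powr (1 / 4))\<^sup>2 = sqrt (2::real)"
    by (simp add: power2_eq_square powr_half_sqrt flip: powr_add)
  moreover have "sqrt (2 * pi * (1 / (2 * sqrt pi))\<^sup>2) = 1 / sqrt 2"
    by (simp add: power_divide power_mult_distrib real_sqrt_divide)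
  moreover have "(exp (- pi * x\<^sup>2))\<^sup>2 = exp (- (x - 0)\<^sup>2 / (2 * (1 / (2 * sqrt pi))\<^sup>2))"
    unfolding exp_double[symmetric] by (simp add: power_divide power_mult_distrib)
  ultimately show ?thesis
    unfolding std_gauss_def normal_density_def power_mult_distrib by simp
qed

lemma integral_std_gauss_square: "(\<integral>x. (std_gauss x)\<^sup>2 \<partial>lborel) = 1"
  by (simp add: std_gauss_square)

text \<open>The logarithm is a quadratic polynomial, so only the second moment enters. Two copies of
  the resulting entropy add up to exactly \<open>1 - ln 2\<close>, the constant in the
  deficit.\<close>

lemma integral_entropy_std_gauss:
  "(\<integral>x. (std_gauss x)\<^sup>2 * ln ((std_gauss x)\<^sup>2) \<partial>lborel) = - (1 - ln 2) / 2"
proof -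
  define \<sigma> :: real where "\<sigma> = 1 / (2 * sqrt pi)"
  have \<sigma>: "0 < \<sigma>" "\<sigma>\<^sup>2 = 1 / (4 * pi)"
    by (simp_all add: \<sigma>_def power_divide power_mult_distrib)
  have ln: "ln ((std_gauss x)\<^sup>2) = ln 2 / 2 - 2 * pi * x\<^sup>2" for x
    by (simp add: std_gauss_def ln_realpow ln_mult ln_powr)
  have 1: "integrable lborel (\<lambda>x. normal_density 0 \<sigma> x * x\<^sup>2)"
    "(\<integral>x. normal_density 0 \<sigma> x * x\<^sup>2 \<partial>lborel) = \<sigma>\<^sup>2"
    using normal_moment_even[OF \<sigma>(1), of 0 1] by (auto simp: has_bochner_integral_iff fact_2)
  have "(\<integral>x. (std_gauss x)\<^sup>2 * ln ((std_gauss x)\<^sup>2) \<partial>lborel)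
     = (\<integral>x. ln 2 / 2 * normal_density 0 \<sigma> x - 2 * pi * (normal_density 0 \<sigma> x * x\<^sup>2) \<partial>lborel)"
    unfolding ln unfolding std_gauss_square \<sigma>_def[symmetric]
    by (intro Bochner_Integration.integral_cong) (auto simp: algebra_simps)
  also have "\<dots> = ln 2 / 2 - 2 * pi * \<sigma>\<^sup>2"
    using 1 \<sigma>(1) by (subst Bochner_Integration.integral_diff) auto
  finally show ?thesis
    by (simp add: \<sigma>(2) field_simps)
qed

text \<open>An affine substitution reduces the integral to the characteristic function of the
  standard normal distribution; the translation by \<open>r\<close> becomes a phase.\<close>

lemma has_bochner_integral_fourier_std_gauss:
  "has_bochner_integral lborel
    (\<lambda>x. exp (- 2 * of_real pi * \<i> * of_real x * of_real \<xi>) * of_real (std_gauss (x - r)))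
    (exp (- 2 * of_real pi * \<i> * of_real r * of_real \<xi>) * of_real (std_gauss \<xi>))"
  (is "has_bochner_integral lborel ?f ?I")
proof -
  \<comment> \<open>The scale \<open>c\<close> turns \<open>exp (- pi * y\<^sup>2)\<close> into
    \<open>exp (- x\<^sup>2 / 2)\<close> for \<open>y = c * x\<close>, and the frequency
    \<open>s\<close> is chosen so that \<open>s * x = - 2 * pi * (c * x) * \<xi>\<close>.\<close>
  define c :: real where "c = 1 / sqrt (2 * pi)"
  have c: "0 < c" "c\<^sup>2 = 1 / (2 * pi)"
    by (simp_all add: c_def power_divide)
  define s :: real where "s = - \<xi> * sqrt (2 * pi)"
  have s: "s = - (2 * pi * c * \<xi>)"
    using real_sqrt_pow2[of "2 * pi"]
    by (simp add: c_def s_def field_simps power2_eq_square)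
  have s2: "s\<^sup>2 / 2 = pi * \<xi>\<^sup>2"
    by (simp add: s_def power_mult_distrib)
  have "char std_normal_distribution s = (\<integral>x. std_normal_density x *\<^sub>R iexp (s * x) \<partial>lborel)"
    unfolding char_def by (subst integral_density) auto
  moreover have int: "integrable lborel (\<lambda>x. std_normal_density x *\<^sub>R iexp (s * x))"
    by (rule Bochner_Integration.integrable_bound[OF integrable_normal_density[of 1 0]])
       (auto simp del: of_real_mult)
  ultimately have "has_bochner_integral lborel (\<lambda>x. std_normal_density x *\<^sub>R iexp (s * x))
      (of_real (exp (- (s\<^sup>2) / 2)))"
    by (simp add: has_bochner_integral_iff char_std_normal_distribution)
  then have "has_bochner_integral lborel (\<lambda>x. std_normal_density x *\<^sub>R iexp (s * x))
      (of_real (exp (- pi * \<xi>\<^sup>2)))"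
    using s2 by simp
  \<comment> \<open>The factor replaces the normalisation of the normal density by that of
    \<open>std_gauss\<close> and inserts the phase of the shift. On the right-hand side the Jacobian
    \<open>1 / c\<close> remains.\<close>
  note has_bochner_integral_mult_right[OF this, of
      "of_real (2 powr (1/4) * sqrt (2 * pi)) * exp (- 2 * of_real pi * \<i> * of_real r * of_real \<xi>)"]
  moreover have "of_real (2 powr (1/4) * sqrt (2 * pi)) * exp (- 2 * of_real pi * \<i> * of_real r * of_real \<xi>)
      * (std_normal_density x *\<^sub>R iexp (s * x)) = ?f (r + c * x)" for x
  proof -
    have "exp (- 2 * of_real pi * \<i> * of_real r * of_real \<xi>) * iexp (s * x)
      = exp (- 2 * of_real pi * \<i> * of_real (r + c * x) * of_real \<xi>)"
      unfolding exp_add[symmetric] s by (simp add: algebra_simps)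
    moreover have "(2 powr (1/4) * sqrt (2 * pi)) * std_normal_density x = std_gauss (r + c * x - r)"
      by (simp add: std_gauss_def std_normal_density_def power_mult_distrib c(2))
    moreover have "of_real (2 powr (1/4) * sqrt (2 * pi)) * e * (y *\<^sub>R i)
        = (e * i) * of_real ((2 powr (1/4) * sqrt (2 * pi)) * y)" for e i :: complex and y :: real
      by (simp add: scaleR_conv_of_real)
    ultimately show ?thesis
      by (simp only:)
  qed
  moreover have "of_real (2 powr (1/4) * sqrt (2 * pi)) * exp (- 2 * of_real pi * \<i> * of_real r * of_real \<xi>)
      * of_real (exp (- pi * \<xi>\<^sup>2)) = ?I /\<^sub>R \<bar>c\<bar>"
    by (simp add: c_def std_gauss_def scaleR_conv_of_real mult_ac)
  ultimately show ?thesis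
    using c(1) by (subst lborel_has_bochner_integral_real_affine_iff[where c = c and t = r]) auto
qed

section \<open>The trial functions: domination, normalisation and vanishing deficit\<close>

definition bumps :: "nat \<Rightarrow> real \<Rightarrow> real" where
  "bumps k x = std_gauss x + exp (- real k) * (std_gauss (x - real k) + std_gauss (x + real k))"

definition bumps_norm :: "nat \<Rightarrow> real" where
  "bumps_norm k = sqrt (\<integral>x. (bumps k x)\<^sup>2 \<partial>lborel)"

definition trial :: "nat \<Rightarrow> real \<Rightarrow> real" where
  "trial k x = bumps k x / bumps_norm k"

lemma borel_measurable_bumps [measurable]: "bumps k \<in> borel_measurable borel"
  unfolding bumps_def by measurable

lemma borel_measurable_trial [measurable]: "trial k \<in> borel_measurable borel"
  unfolding trial_def by measurable

lemma std_gauss_le_exp: "std_gauss y \<le> 6 * exp (- \<bar>y\<bar>)"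
proof -
  have "2 powr (1 / 4) \<le> (2::real)"
    using powr_mono[of "1 / 4" 1 "2::real"] by simp
  moreover have "exp (- pi * y\<^sup>2) \<le> 3 * exp (- \<bar>y\<bar>)"
  proof -
    have "0 \<le> (\<bar>y\<bar> - 1)\<^sup>2"
      by simp
    then have "\<bar>y\<bar> - 1 \<le> 1 * y\<^sup>2"
      by (simp add: power2_diff)
    also have "\<dots> \<le> pi * y\<^sup>2"
      using pi_gt3 by (intro mult_right_mono) auto
    finally have "exp (- pi * y\<^sup>2) \<le> exp (1 + - \<bar>y\<bar>)"
      by simp
    also have "\<dots> \<le> 3 * exp (- \<bar>y\<bar>)"
      unfolding exp_add using exp_le by (intro mult_right_mono) auto
    finally show ?thesis .
  qed
  ultimately have "std_gauss y \<le> 2 * (3 * exp (- \<bar>y\<bar>))"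
    unfolding std_gauss_def by (intro mult_mono) auto
  then show ?thesis
    by simp
qed

lemma std_gauss_le_6: "std_gauss y \<le> 6"
proof -
  have "6 * exp (- \<bar>y\<bar>) \<le> 6"
    by simp
  then show ?thesis
    using std_gauss_le_exp[of y] by linarith
qed

lemma std_gauss_le_bumps: "std_gauss x \<le> bumps k x"
  by (simp add: bumps_def std_gauss_pos less_imp_le)

lemma bumps_pos: "0 < bumps k x"
  using std_gauss_le_bumps[of x k] std_gauss_pos[of x] by linarith

text \<open>Moving a centre by \<open>k\<close> costs at most a factor \<open>exp k\<close> in a
  bound by \<open>exp (- \<bar>x\<bar>)\<close>, and the coefficient \<open>exp (- real k)\<close>
  pays exactly for that. Hence one majorant serves all \<open>k\<close>; 18 is three times the 6 of
  \<open>std_gauss_le_exp\<close>.\<close>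

lemma bumps_le_exp: "bumps k x \<le> 18 * exp (- \<bar>x\<bar>)"
proof -
  have *: "exp (- real k) * std_gauss y \<le> 6 * exp (- \<bar>x\<bar>)" if "\<bar>x\<bar> \<le> real k + \<bar>y\<bar>" for y
  proof -
    have "exp (- real k) * std_gauss y \<le> exp (- real k) * (6 * exp (- \<bar>y\<bar>))"
      by (intro mult_left_mono std_gauss_le_exp) auto
    also have "\<dots> = 6 * exp (- (real k + \<bar>y\<bar>))"
      by (simp add: exp_add[symmetric])
    also have "\<dots> \<le> 6 * exp (- \<bar>x\<bar>)"
      using that by simp
    finally show ?thesis .
  qed
  have "\<bar>x\<bar> \<le> real k + \<bar>x - real k\<bar>" "\<bar>x\<bar> \<le> real k + \<bar>x + real k\<bar>"
    by linarith+
  from *[OF this(1)] *[OF this(2)] std_gauss_le_exp[of x] show ?thesis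
    unfolding bumps_def distrib_left by linarith
qed

lemma exp_minus_nat_tendsto_0: "(\<lambda>k. exp (- real k)) \<longlonglongrightarrow> 0"
  by (intro filterlim_compose[OF exp_at_bot] filterlim_uminus_at_top[THEN iffD1]
      filterlim_real_sequentially)

lemma bumps_tendsto: "(\<lambda>k. bumps k x) \<longlonglongrightarrow> std_gauss x"
proof -
  have "(\<lambda>k. exp (- real k) * (std_gauss (x - real k) + std_gauss (x + real k))) \<longlonglongrightarrow> 0"
  proof (rule Lim_null_comparison)
    have "std_gauss (x - real k) + std_gauss (x + real k) \<le> 12" for k
      using std_gauss_le_6[of "x - real k"] std_gauss_le_6[of "x + real k"] by simp
    moreover have "0 \<le> std_gauss (x - real k) + std_gauss (x + real k)" for k
      by (simp add: std_gauss_pos less_imp_le)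
    ultimately show "\<forall>\<^sub>F k in sequentially.
        norm (exp (- real k) * (std_gauss (x - real k) + std_gauss (x + real k))) \<le> exp (- real k) * 12"
      by (simp add: abs_mult)
    show "(\<lambda>k. exp (- real k) * 12) \<longlonglongrightarrow> 0"
      by (rule tendsto_mult_left_zero[OF exp_minus_nat_tendsto_0])
  qed
  then show ?thesis
    unfolding bumps_def by (rule tendsto_add[OF tendsto_const, of _ 0, simplified])
qed

lemma bumps_square_le: "(bumps k x)\<^sup>2 \<le> 324 * exp (- \<bar>x\<bar>)"
proof -
  have "(bumps k x)\<^sup>2 \<le> (18 * exp (- \<bar>x\<bar>)) * (18 * 1)"
    unfolding power2_eq_square
    using bumps_le_exp[of k x] bumps_pos[of k x]
    by (intro mult_mono) (auto intro: order_trans[OF bumps_le_exp])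
  then show ?thesis
    by simp
qed

lemma integrable_bumps_square: "integrable lborel (\<lambda>x. (bumps k x)\<^sup>2)"
  by (rule Bochner_Integration.integrable_bound[of _ "\<lambda>x. 324 * exp (- \<bar>x\<bar>)"])
     (use integrable_exp_minus_abs bumps_square_le in auto)

text \<open>\<open>bumps\<close> lies above \<open>std_gauss\<close>, which has norm 1. Consequently
  normalising never enlarges a function, and upper bounds for \<open>bumps\<close> carry over to
  \<open>trial\<close>.\<close>

lemma bumps_norm_ge_1: "1 \<le> bumps_norm k"
proof -
  have "1 = (\<integral>x. (std_gauss x)\<^sup>2 \<partial>lborel)"
    by (simp add: integral_std_gauss_square)
  also have "\<dots> \<le> (\<integral>x. (bumps k x)\<^sup>2 \<partial>lborel)"
  proof (rule integral_mono[OF _ integrable_bumps_square])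
    show "integrable lborel (\<lambda>x. (std_gauss x)\<^sup>2)"
      by (simp add: std_gauss_square)
    show "(std_gauss x)\<^sup>2 \<le> (bumps k x)\<^sup>2" for x
      by (intro power_mono std_gauss_le_bumps) (simp add: std_gauss_pos less_imp_le)
  qed
  finally show ?thesis
    by (simp add: bumps_norm_def)
qed

lemma bumps_norm_tendsto: "bumps_norm \<longlonglongrightarrow> 1"
proof -
  have "(\<lambda>k. \<integral>x. (bumps k x)\<^sup>2 \<partial>lborel) \<longlonglongrightarrow> (\<integral>x. (std_gauss x)\<^sup>2 \<partial>lborel)"
  proof (rule integral_dominated_convergence[where w = "\<lambda>x. 324 * exp (- \<bar>x\<bar>)"])
    show "AE x in lborel. (\<lambda>k. (bumps k x)\<^sup>2) \<longlonglongrightarrow> (std_gauss x)\<^sup>2"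
      by (intro AE_I2 tendsto_power bumps_tendsto)
  qed (use integrable_exp_minus_abs bumps_square_le in auto)
  from tendsto_real_sqrt[OF this] show ?thesis
    unfolding bumps_norm_def[abs_def] by (simp add: integral_std_gauss_square)
qed

lemma trial_nonneg: "0 \<le> trial k x"
  using bumps_pos[of k x] bumps_norm_ge_1[of k] by (simp add: trial_def)

lemma divide_bumps_norm_le: "0 \<le> a \<Longrightarrow> a \<le> b \<Longrightarrow> a / bumps_norm k \<le> b"
  using bumps_norm_ge_1[of k] frac_le[of b a 1 "bumps_norm k"] by simp

lemma Lp_norm_2_trial: "Lp_norm 2 lborel (trial k) = 1"
proof -
  have "(\<integral>\<^sup>+ x. ennreal (\<bar>trial k x\<bar> powr 2) \<partial>lborel)
      = (\<integral>\<^sup>+ x. ennreal ((bumps k x)\<^sup>2 / (bumps_norm k)\<^sup>2) \<partial>lborel)"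
    using trial_nonneg[of k] by (intro nn_integral_cong) (simp add: trial_def power_divide)
  also have "\<dots> = ennreal (\<integral>x. (bumps k x)\<^sup>2 / (bumps_norm k)\<^sup>2 \<partial>lborel)"
    by (intro nn_integral_eq_integral integrable_divide integrable_bumps_square) auto
  also have "(\<integral>x. (bumps k x)\<^sup>2 / (bumps_norm k)\<^sup>2 \<partial>lborel) = 1"
    using bumps_norm_ge_1[of k] by (simp add: bumps_norm_def)
  finally show ?thesis
    by (simp add: Lp_norm_def)
qed

text \<open>The two opposite shifts contribute conjugate phases, whose sum is twice a cosine; this
  makes the transform real.\<close>

lemma fourier_trial:
  "fourier (trial k) \<xi>
    = of_real (std_gauss \<xi> * (1 + 2 * exp (- real k) * cos (2 * pi * real k * \<xi>)) / bumps_norm k)"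
proof -
  let ?E = "\<lambda>r. exp (- 2 * of_real pi * \<i> * of_real r * of_real \<xi>) :: complex"
  let ?F = "\<lambda>r x. ?E x * of_real (std_gauss (x - r))"
  have F: "integrable lborel (?F r)" "(\<integral>x. ?F r x \<partial>lborel) = ?E r * of_real (std_gauss \<xi>)" for r
    using has_bochner_integral_fourier_std_gauss[of \<xi> r] by (auto simp: has_bochner_integral_iff)
  let ?e = "of_real (exp (- real k)) :: complex"
  have "fourier (trial k) \<xi>
      = (\<integral>x. (?F 0 x + ?e * (?F (real k) x + ?F (- real k) x)) / of_real (bumps_norm k) \<partial>lborel)"
    unfolding fourier_def trial_def bumps_def
    by (intro Bochner_Integration.integral_cong refl) (simp add: algebra_simps add_divide_distrib)
  also have "\<dots> = (?E 0 * of_real (std_gauss \<xi>)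
      + ?e * (?E (real k) * of_real (std_gauss \<xi>) + ?E (- real k) * of_real (std_gauss \<xi>)))
      / of_real (bumps_norm k)"
    unfolding F(2)[symmetric]
    by (subst integral_divide_zero, subst Bochner_Integration.integral_add,
        (intro F(1) integrable_mult_right Bochner_Integration.integrable_add)+,
        subst integral_mult_right_zero, subst Bochner_Integration.integral_add) (intro F(1) refl)+
  also have "?E (real k) = cis (- (2 * pi * real k * \<xi>))"
    by (simp add: cis_conv_exp mult_ac)
  also have "?E (- real k) = cis (2 * pi * real k * \<xi>)"
    by (simp add: cis_conv_exp mult_ac)
  also have "(?E 0 * of_real (std_gauss \<xi>)
      + ?e * (cis (- (2 * pi * real k * \<xi>)) * of_real (std_gauss \<xi>)
        + cis (2 * pi * real k * \<xi>) * of_real (std_gauss \<xi>))) / of_real (bumps_norm k)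
    = of_real (std_gauss \<xi> * (1 + 2 * exp (- real k) * cos (2 * pi * real k * \<xi>)) / bumps_norm k)"
    by (simp add: complex_eq_iff algebra_simps)
  finally show ?thesis .
qed

text \<open>The cosine factor has modulus at most 3 and the normalisation is at least 1, so the
  majorant is the same as for \<open>trial\<close> itself.\<close>

lemma cmod_fourier_trial_le: "cmod (fourier (trial k) \<xi>) \<le> 18 * exp (- \<bar>\<xi>\<bar>)"
proof -
  have "exp (- real k) * \<bar>cos (2 * pi * real k * \<xi>)\<bar> \<le> 1 * 1"
    by (intro mult_mono) auto
  then have "\<bar>1 + 2 * exp (- real k) * cos (2 * pi * real k * \<xi>)\<bar> \<le> 3"
    by (intro order_trans[OF abs_triangle_ineq]) (simp add: abs_mult)
  then have "std_gauss \<xi> * \<bar>1 + 2 * exp (- real k) * cos (2 * pi * real k * \<xi>)\<bar>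
      \<le> (6 * exp (- \<bar>\<xi>\<bar>)) * 3"
    using std_gauss_pos[of \<xi>] by (intro mult_mono std_gauss_le_exp) auto
  moreover have "cmod (fourier (trial k) \<xi>)
      = std_gauss \<xi> * \<bar>1 + 2 * exp (- real k) * cos (2 * pi * real k * \<xi>)\<bar> / bumps_norm k"
    unfolding fourier_trial norm_of_real
    using bumps_norm_ge_1[of k] std_gauss_pos[of \<xi>] by (simp add: abs_mult)
  ultimately show ?thesis
    using std_gauss_pos[of \<xi>] by (simp add: divide_bumps_norm_le)
qed

lemma cmod_fourier_trial_tendsto: "(\<lambda>k. cmod (fourier (trial k) \<xi>)) \<longlonglongrightarrow> std_gauss \<xi>"
proof -
  \<comment> \<open>The cosine oscillates as \<open>k\<close> grows, but its coefficient damps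
    it.\<close>
  have "(\<lambda>k. exp (- real k) * cos (2 * pi * real k * \<xi>)) \<longlonglongrightarrow> 0"
  proof (rule Lim_null_comparison[OF _ exp_minus_nat_tendsto_0])
    show "\<forall>\<^sub>F k in sequentially. norm (exp (- real k) * cos (2 * pi * real k * \<xi>)) \<le> exp (- real k)"
      by (simp add: abs_mult mult_left_le)
  qed
  from tendsto_mult_right_zero[OF this, of 2]
  have "(\<lambda>k. std_gauss \<xi> * (1 + 2 * exp (- real k) * cos (2 * pi * real k * \<xi>)) / bumps_norm k)
      \<longlonglongrightarrow> std_gauss \<xi> * (1 + 0) / 1"
    by (intro tendsto_intros bumps_norm_tendsto) (auto simp: mult_ac)
  then have "(\<lambda>k. fourier (trial k) \<xi>) \<longlonglongrightarrow> of_real (std_gauss \<xi> * (1 + 0) / 1)"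
    unfolding fourier_trial by (rule tendsto_of_real)
  from tendsto_norm[OF this] show ?thesis
    using std_gauss_pos[of \<xi>] by simp
qed

text \<open>\<open>std_gauss\<close> is its own Fourier transform, so both entropies have the same
  limit \<open>(1 - ln 2) / 2\<close>.\<close>

lemma delta_BH_trial_tendsto: "(\<lambda>k. delta_BH (trial k)) \<longlonglongrightarrow> 0"
proof -
  let ?S = "ereal (- (\<integral>x. (std_gauss x)\<^sup>2 * ln ((std_gauss x)\<^sup>2) \<partial>lborel))"
  have "(\<lambda>k. entropy (\<lambda>x. (trial k x)\<^sup>2)) \<longlonglongrightarrow> ?S"
  proof (rule entropy_square_tendsto[where C = 18])
    show "trial k x \<le> 18 * exp (- \<bar>x\<bar>)" for k x
      unfolding trial_def
      using bumps_pos[of k x] bumps_le_exp[of k x] by (intro divide_bumps_norm_le) auto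
    show "(\<lambda>k. trial k x) \<longlonglongrightarrow> std_gauss x" for x
      unfolding trial_def
      using tendsto_divide[OF bumps_tendsto bumps_norm_tendsto, of x] by simp
  qed (auto simp: trial_nonneg std_gauss_pos)
  moreover have "(\<lambda>k. entropy (\<lambda>\<xi>. (cmod (fourier (trial k) \<xi>))\<^sup>2)) \<longlonglongrightarrow> ?S"
  proof (rule entropy_square_tendsto[where C = 18])
    show "(\<lambda>\<xi>. cmod (fourier (trial k) \<xi>)) \<in> borel_measurable borel" for k
      unfolding fourier_trial by measurable
  qed (auto simp: cmod_fourier_trial_le cmod_fourier_trial_tendsto std_gauss_pos)
  ultimately have "(\<lambda>k. delta_BH (trial k)) \<longlonglongrightarrow> ?S + ?S - ereal (1 - ln 2)"
    unfolding delta_BH_def power2_abs by (intro tendsto_intros) auto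
  also have "?S + ?S - ereal (1 - ln 2) = 0"
    unfolding integral_entropy_std_gauss by (simp add: zero_ereal_def)
  finally show ?thesis .
qed

section \<open>Superlevel sets of quadratics, Gaussian integrals and quasi-norm bounds\<close>

lemma quadratic_superlevel:
  fixes \<alpha> \<beta> \<gamma> c x\<^sub>1 y x\<^sub>2 z :: real
  defines "q \<equiv> \<lambda>x. \<alpha> * x\<^sup>2 + \<beta> * x + \<gamma>"
  assumes "x\<^sub>1 < y" "y < x\<^sub>2" "x\<^sub>2 < z" and ge: "c \<le> q x\<^sub>1" "c \<le> q x\<^sub>2"
  shows "c \<le> q y \<or> c \<le> q z"
proof (rule ccontr)
  assume "\<not> ?thesis"
  then have less: "q y < c" "q z < c"
    by auto
  \<comment> \<open>This compares the value at \<open>v\<close> with the chord from \<open>u\<close>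
    to \<open>w\<close>; the error has the sign of the leading coefficient. Instantiations below
    list \<open>w\<close>, \<open>u\<close>, \<open>v\<close> in this order.\<close>
  have chord: "(w - u) * q v = (w - v) * q u + (v - u) * q w - \<alpha> * ((w - u) * (v - u) * (w - v))"
    for u v w
    unfolding q_def by algebra
  show False
  proof (cases "\<alpha> \<le> 0")
    case True
    \<comment> \<open>Concave case: \<open>q y\<close> is at least the chord from
      \<open>x\<^sub>1\<close> to \<open>x\<^sub>2\<close>, whose end values are at least
      \<open>c\<close>.\<close>
    have "(x\<^sub>2 - x\<^sub>1) * q y < (x\<^sub>2 - x\<^sub>1) * c"
      using less assms by simp
    moreover have "(x\<^sub>2 - y) * c \<le> (x\<^sub>2 - y) * q x\<^sub>1" "(y - x\<^sub>1) * c \<le> (y - x\<^sub>1) * q x\<^sub>2"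
      using ge assms by (auto intro: mult_left_mono)
    moreover have "\<alpha> * ((x\<^sub>2 - x\<^sub>1) * (y - x\<^sub>1) * (x\<^sub>2 - y)) \<le> 0"
      using True assms by (intro mult_nonpos_nonneg) auto
    moreover have "(x\<^sub>2 - x\<^sub>1) * c = (x\<^sub>2 - y) * c + (y - x\<^sub>1) * c"
      by algebra
    ultimately show False
      using chord[of x\<^sub>2 x\<^sub>1 y] by linarith
  next
    case False
    \<comment> \<open>Convex case: \<open>x\<^sub>2\<close> lies between \<open>y\<close> and
      \<open>z\<close>, so \<open>q x\<^sub>2\<close> is at most a chord that stays below
      \<open>c\<close>.\<close>
    have "(z - y) * c \<le> (z - y) * q x\<^sub>2"
      using ge assms by (intro mult_left_mono) auto
    moreover have "(z - x\<^sub>2) * q y < (z - x\<^sub>2) * c" "(x\<^sub>2 - y) * q z < (x\<^sub>2 - y) * c"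
      using less assms by auto
    moreover have "0 \<le> \<alpha> * ((z - y) * (x\<^sub>2 - y) * (z - x\<^sub>2))"
      using False assms by simp
    moreover have "(z - y) * c = (z - x\<^sub>2) * c + (x\<^sub>2 - y) * c"
      by algebra
    ultimately show False
      using chord[of z y x\<^sub>2] by linarith
  qed
qed

lemma nn_integral_exp_square:
  assumes "0 < b"
  shows "(\<integral>\<^sup>+ x. ennreal (exp (- b * (x - y)\<^sup>2)) \<partial>lborel) = ennreal (sqrt (pi / b))"
proof -
  define \<sigma> where "\<sigma> = 1 / sqrt (2 * b)"
  have \<sigma>: "0 < \<sigma>" "\<sigma>\<^sup>2 = 1 / (2 * b)"
    using assms by (simp_all add: \<sigma>_def power_divide)
  have "exp (- b * (x - y)\<^sup>2) = sqrt (pi / b) * normal_density y \<sigma> x" for x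
    using assms by (simp add: normal_density_def \<sigma>(2) real_sqrt_divide)
  then have "(\<integral>\<^sup>+ x. ennreal (exp (- b * (x - y)\<^sup>2)) \<partial>lborel)
      = (\<integral>\<^sup>+ x. ennreal (sqrt (pi / b) * normal_density y \<sigma> x) \<partial>lborel)"
    by simp
  also have "\<dots> = ennreal (\<integral>x. sqrt (pi / b) * normal_density y \<sigma> x \<partial>lborel)"
    using \<sigma>(1) assms by (intro nn_integral_eq_integral) auto
  finally show ?thesis
    using \<sigma>(1) by simp
qed

lemma ennreal_inverse_antimono: "(a::ennreal) \<le> b \<Longrightarrow> inverse b \<le> inverse a"
  by (cases a; cases b; cases "a = 0") (auto simp: inverse_ennreal top_unique intro!: ennreal_leI le_imp_inverse_le)

text \<open>Comparing the sum with three times the maximum works for every \<open>p > 0\<close>,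
  including \<open>p < 1\<close>, where the triangle inequality for the norm fails.\<close>

lemma powr_add3_le:
  fixes a b c p :: real
  assumes "0 \<le> a" "0 \<le> b" "0 \<le> c" "0 < p"
  shows "(a + b + c) powr p \<le> 3 powr p * (a powr p + b powr p + c powr p)"
proof -
  have "(a + b + c) powr p \<le> (3 * Max {a, b, c}) powr p"
    using assms by (intro powr_mono2) (auto simp: max_def)
  also have "\<dots> = 3 powr p * Max {a, b, c} powr p"
    using assms by (intro powr_mult)
  also have "\<dots> \<le> 3 powr p * (a powr p + b powr p + c powr p)"
    by (intro mult_left_mono) (auto simp: max_def)
  finally show ?thesis .
qed

lemma Lp_norm_le:
  assumes "0 < p" "0 \<le> K" and "(\<integral>\<^sup>+ x. ennreal (\<bar>u x\<bar> powr p) \<partial>M) \<le> ennreal K"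
  shows "Lp_norm p M u \<le> ennreal (K powr (1 / p))"
proof -
  have "(\<integral>\<^sup>+ x. ennreal (\<bar>u x\<bar> powr p) \<partial>M) \<noteq> \<infinity>"
    using assms(3) by (auto simp: top_unique)
  moreover have "enn2real (\<integral>\<^sup>+ x. ennreal (\<bar>u x\<bar> powr p) \<partial>M) \<le> K"
    using assms by (intro enn2real_leI)
  ultimately show ?thesis
    using assms(1) by (auto simp: Lp_norm_def intro!: ennreal_leI powr_mono2)
qed

lemma Lp_norm_ge:
  assumes "0 < p" "0 \<le> K" and "ennreal (K powr p) \<le> (\<integral>\<^sup>+ x. ennreal (\<bar>u x\<bar> powr p) \<partial>M)"
  shows "ennreal K \<le> Lp_norm p M u"
proof (cases "\<integral>\<^sup>+ x. ennreal (\<bar>u x\<bar> powr p) \<partial>M")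
  case (real I)
  then have "(K powr p) powr (1 / p) \<le> I powr (1 / p)"
    using assms by (intro powr_mono2) auto
  then show ?thesis
    using assms real by (auto simp: Lp_norm_def powr_powr intro!: ennreal_leI)
qed (simp add: Lp_norm_def)

section \<open>The trial functions after weighting\<close>

context
  fixes p \<theta> :: real
  assumes \<theta>: "0 < \<theta>" "\<theta> < p"
begin

definition root_weight :: "real \<Rightarrow> real" where
  "root_weight x = std_gauss x powr (- \<theta> / p)"

lemma root_weight_eq: "root_weight x = 2 powr (- \<theta> / (4 * p)) * exp (pi * \<theta> / p * x\<^sup>2)"
  using \<theta> by (simp add: root_weight_def std_gauss_def powr_mult powr_powr exp_powr_real mult_ac)

lemma root_weight_pos: "0 < root_weight x"
  by (simp add: root_weight_eq)

lemma borel_measurable_root_weight [measurable]: "root_weight \<in> borel_measurable borel"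
  unfolding root_weight_def by measurable

lemma nn_integral_m_theta:
  assumes [measurable]: "u \<in> borel_measurable borel"
  shows "(\<integral>\<^sup>+ x. ennreal (\<bar>u x\<bar> powr p) \<partial>m_theta \<theta>)
    = (\<integral>\<^sup>+ x. ennreal ((\<bar>u x\<bar> * root_weight x) powr p) \<partial>lborel)"
proof -
  have "root_weight x powr p = std_gauss x powr - \<theta>" for x
    using \<theta> by (simp add: root_weight_def powr_powr)
  then show ?thesis
    unfolding m_theta_def using root_weight_pos
    by (subst nn_integral_density)
       (auto simp: powr_mult ennreal_mult' mult_ac less_imp_le intro!: nn_integral_cong)
qed

text \<open>An interval of length 1 has Lebesgue measure 1, so the powers \<open>p\<close> and
  \<open>1 / p\<close> cancel and a pointwise lower bound passes to the norm without loss.\<close>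

lemma Lp_norm_m_theta_ge:
  assumes u: "u \<in> borel_measurable borel" and "0 \<le> \<tau>"
    and ge: "\<And>x. x \<in> {w..w + 1} \<Longrightarrow> \<tau> \<le> \<bar>u x\<bar> * root_weight x"
  shows "ennreal \<tau> \<le> Lp_norm p (m_theta \<theta>) u"
proof (rule Lp_norm_ge)
  have "ennreal (\<tau> powr p) = (\<integral>\<^sup>+ x. ennreal (\<tau> powr p) * indicator {w..w + 1} x \<partial>lborel)"
    by (simp add: nn_integral_cmult_indicator)
  also have "\<dots> \<le> (\<integral>\<^sup>+ x. ennreal ((\<bar>u x\<bar> * root_weight x) powr p) \<partial>lborel)"
    using \<theta> ge assms(2) by (intro nn_integral_mono) (auto simp: indicator_def intro!: ennreal_leI powr_mono2)
  finally show "ennreal (\<tau> powr p) \<le> (\<integral>\<^sup>+ x. ennreal (\<bar>u x\<bar> powr p) \<partial>m_theta \<theta>)"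
    by (simp add: nn_integral_m_theta u)
qed (use \<theta> assms in auto)

text \<open>These constants come from completing the square in
  \<open>- pi * (x - s)\<^sup>2 + pi * \<theta> / p * x\<^sup>2\<close>. The decay rate left after
  weighting is \<open>\<kappa>\<close>, positive because \<open>\<theta> < p\<close>; the new centre
  is \<open>\<Lambda> * s\<close>; the gain in height is \<open>exp (\<mu> * s\<^sup>2)\<close>. In
  \<open>height\<close> this gain for \<open>s = k\<close> is combined with the coefficient
  \<open>exp (- real k)\<close>.\<close>

definition \<kappa> :: real where "\<kappa> = pi * (1 - \<theta> / p)"
definition \<mu> :: real where "\<mu> = pi * \<theta> / (p - \<theta>)"
definition \<Lambda> :: real where "\<Lambda> = p / (p - \<theta>)"
definition amp :: real where "amp = 2 powr (1 / 4) * 2 powr (- \<theta> / (4 * p))"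
definition height :: "nat \<Rightarrow> real" where "height k = exp (\<mu> * (real k)\<^sup>2 - real k)"

lemma constants_pos: "0 < \<kappa>" "0 < \<mu>" "0 < \<Lambda>" "0 < amp" "0 < height k"
  using \<theta> by (auto simp: \<kappa>_def \<mu>_def \<Lambda>_def amp_def height_def)

lemma std_gauss_shift_weighted:
  "std_gauss (x - s) * root_weight x = amp * exp (\<mu> * s\<^sup>2) * exp (- \<kappa> * (x - \<Lambda> * s)\<^sup>2)"
proof -
  have "- pi * (x - s)\<^sup>2 + pi * \<theta> / p * x\<^sup>2 = \<mu> * s\<^sup>2 + - \<kappa> * (x - \<Lambda> * s)\<^sup>2"
  proof -
    \<comment> \<open>The three relations match the coefficients of \<open>x * s\<close>,
      \<open>s\<^sup>2\<close> and \<open>x\<^sup>2\<close>.\<close>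
    have 1: "\<kappa> * \<Lambda> = pi" and 2: "pi * \<Lambda> = \<mu> + pi" and 3: "pi * \<theta> / p = pi - \<kappa>"
      using \<theta> by (simp_all add: \<kappa>_def \<mu>_def \<Lambda>_def field_simps)
    have "\<kappa> * (x - \<Lambda> * s)\<^sup>2 = \<kappa> * x\<^sup>2 - 2 * (\<kappa> * \<Lambda>) * x * s + (\<kappa> * \<Lambda>) * \<Lambda> * s\<^sup>2"
      by algebra
    also have "\<dots> = \<kappa> * x\<^sup>2 - 2 * pi * x * s + (\<mu> + pi) * s\<^sup>2"
      unfolding 1 2 ..
    finally show ?thesis
      unfolding 3 by (simp add: power2_diff algebra_simps)
  qed
  then show ?thesis
    unfolding std_gauss_def root_weight_eq amp_def mult_exp_exp[symmetric]
    by (metis (no_types, opaque_lifting) exp_add mult.assoc mult.left_commute)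
qed

lemma trial_weighted:
  "trial k x * root_weight x = amp / bumps_norm k * (exp (- \<kappa> * x\<^sup>2)
    + height k * (exp (- \<kappa> * (x - \<Lambda> * real k)\<^sup>2) + exp (- \<kappa> * (x + \<Lambda> * real k)\<^sup>2)))"
proof -
  have "trial k x * root_weight x = (std_gauss (x - 0) * root_weight x + exp (- real k) *
      (std_gauss (x - real k) * root_weight x + std_gauss (x - (- real k)) * root_weight x)) / bumps_norm k"
    by (simp add: trial_def bumps_def algebra_simps add_divide_distrib)
  also have "\<dots> = amp / bumps_norm k * (exp (- \<kappa> * x\<^sup>2) + (exp (- real k) * exp (\<mu> * (real k)\<^sup>2)) *
     (exp (- \<kappa> * (x - \<Lambda> * real k)\<^sup>2) + exp (- \<kappa> * (x + \<Lambda> * real k)\<^sup>2)))"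
    unfolding std_gauss_shift_weighted by (simp add: algebra_simps add_divide_distrib)
  also have "exp (- real k) * exp (\<mu> * (real k)\<^sup>2) = height k"
    by (simp add: height_def exp_diff exp_minus field_simps)
  finally show ?thesis .
qed

text \<open>The coefficients of all three bumps are at most \<open>max 1 (height k)\<close>, and
  each bump contributes the same integral \<open>sqrt (pi / (\<kappa> * p))\<close>;
  \<open>powr_add3_le\<close> combines them.\<close>

lemma Lp_norm_trial_le:
  "Lp_norm p (m_theta \<theta>) (trial k)
    \<le> ennreal (3 * amp * (3 * sqrt (pi / (\<kappa> * p))) powr (1 / p) * max 1 (height k))"
proof -
  define m where "m = max 1 (height k)"
  define E where "E s x = exp (- \<kappa> * (x - s)\<^sup>2)" for s x
  define X where "X = \<Lambda> * real k"
  have b: "0 < \<kappa> * p"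
    using constants_pos \<theta> by simp
  have E: "(\<integral>\<^sup>+ x. ennreal (E s x powr p) \<partial>lborel) = ennreal (sqrt (pi / (\<kappa> * p)))" for s
    using nn_integral_exp_square[OF b, of s] by (simp add: E_def exp_powr_real mult_ac)
  have [measurable]: "E s \<in> borel_measurable borel" for s
    unfolding E_def[abs_def] by measurable
  have le: "\<bar>trial k x\<bar> * root_weight x \<le> amp * m * (E 0 x + E X x + E (- X) x)" for x
  proof -
    have "\<bar>trial k x\<bar> * root_weight x = (amp * (E 0 x + height k * (E X x + E (- X) x))) / bumps_norm k"
      using trial_nonneg[of k x] trial_weighted[of k x] by (simp add: E_def X_def)
    also have "\<dots> \<le> amp * (E 0 x + height k * (E X x + E (- X) x))"
      using constants_pos by (intro divide_bumps_norm_le) (auto simp: E_def less_imp_le)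
    also have "\<dots> \<le> amp * (m * E 0 x + m * (E X x + E (- X) x))"
      using constants_pos
      by (intro mult_left_mono add_mono mult_right_mono) (auto simp: m_def E_def less_imp_le mult_le_cancel_right1)
    finally show ?thesis
      by (simp add: algebra_simps)
  qed
  define K where "K = (3 * amp * m) powr p * (3 * sqrt (pi / (\<kappa> * p)))"
  have m: "0 < m"
    by (simp add: m_def)
  have "(\<integral>\<^sup>+ x. ennreal ((\<bar>trial k x\<bar> * root_weight x) powr p) \<partial>lborel)
      \<le> (\<integral>\<^sup>+ x. ennreal ((3 * amp * m) powr p) *
          (ennreal (E 0 x powr p) + ennreal (E X x powr p) + ennreal (E (- X) x powr p)) \<partial>lborel)"
  proof (rule nn_integral_mono)
    fix x
    have "(\<bar>trial k x\<bar> * root_weight x) powr p \<le> (amp * m * (E 0 x + E X x + E (- X) x)) powr p"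
      using le[of x] \<theta> root_weight_pos[of x] by (intro powr_mono2) auto
    also have "\<dots> = (amp * m) powr p * (E 0 x + E X x + E (- X) x) powr p"
      by (rule powr_mult)
    also have "\<dots> \<le> (amp * m) powr p * (3 powr p * (E 0 x powr p + E X x powr p + E (- X) x powr p))"
      using \<theta> by (intro mult_left_mono powr_add3_le) (auto simp: E_def)
    also have "\<dots> = (3 * amp * m) powr p * (E 0 x powr p + E X x powr p + E (- X) x powr p)"
      by (simp add: powr_mult mult_ac)
    finally show "ennreal ((\<bar>trial k x\<bar> * root_weight x) powr p) \<le> ennreal ((3 * amp * m) powr p) *
          (ennreal (E 0 x powr p) + ennreal (E X x powr p) + ennreal (E (- X) x powr p))"
      by (simp add: ennreal_mult'[symmetric] ennreal_plus[symmetric] del: ennreal_plus)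
  qed
  also have "\<dots> = ennreal ((3 * amp * m) powr p) * (ennreal (sqrt (pi / (\<kappa> * p)))
      + ennreal (sqrt (pi / (\<kappa> * p))) + ennreal (sqrt (pi / (\<kappa> * p))))"
    by (simp add: nn_integral_cmult nn_integral_add E)
  also have "\<dots> = ennreal K"
    using b by (simp add: K_def ennreal_mult'[symmetric] ennreal_plus[symmetric] del: ennreal_plus)
  finally have "Lp_norm p (m_theta \<theta>) (trial k) \<le> ennreal (K powr (1 / p))"
    using \<theta> b by (intro Lp_norm_le) (auto simp: nn_integral_m_theta K_def)
  also have "K powr (1 / p) = 3 * amp * (3 * sqrt (pi / (\<kappa> * p))) powr (1 / p) * m"
    using \<theta> constants_pos m by (simp add: K_def powr_mult powr_powr)
  finally show ?thesis
    by (simp add: m_def)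
qed

lemma trial_in_Lp: "trial k \<in> Lp p (m_theta \<theta>)"
  using Lp_norm_trial_le[of k]
  by (auto simp: Lp_def m_theta_def intro: le_less_trans)

text \<open>Each window starts at the centre of an outer bump and has length 1, so that bump is at
  least \<open>exp (- \<kappa>)\<close> there; the other terms are nonnegative.\<close>

lemma trial_weighted_ge:
  assumes "x \<in> {\<Lambda> * real k..\<Lambda> * real k + 1} \<or> x \<in> {- \<Lambda> * real k - 1..- \<Lambda> * real k}"
  shows "amp * height k * exp (- \<kappa>) / bumps_norm k \<le> trial k x * root_weight x"
proof -
  have E: "exp (- \<kappa>) \<le> exp (- \<kappa> * y\<^sup>2)" if "\<bar>y\<bar> \<le> 1" for y
    using that constants_pos by (simp add: mult_left_le abs_square_le_1)
  have "exp (- \<kappa>) \<le> exp (- \<kappa> * (x - \<Lambda> * real k)\<^sup>2) + exp (- \<kappa> * (x + \<Lambda> * real k)\<^sup>2)"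
    using assms
  proof
    assume "x \<in> {\<Lambda> * real k..\<Lambda> * real k + 1}"
    then show ?thesis
      using E[of "x - \<Lambda> * real k"] by (simp add: abs_le_iff add_increasing2)
  next
    assume "x \<in> {- \<Lambda> * real k - 1..- \<Lambda> * real k}"
    then show ?thesis
      using E[of "x + \<Lambda> * real k"] by (simp add: abs_le_iff add_increasing)
  qed
  then have "height k * exp (- \<kappa>) \<le> exp (- \<kappa> * x\<^sup>2)
      + height k * (exp (- \<kappa> * (x - \<Lambda> * real k)\<^sup>2) + exp (- \<kappa> * (x + \<Lambda> * real k)\<^sup>2))"
    using constants_pos(5)[of k] by (intro add_increasing[OF _ mult_left_mono]) auto
  then have "amp / bumps_norm k * (height k * exp (- \<kappa>)) \<le> trial k x * root_weight x"
    unfolding trial_weighted using constants_pos bumps_norm_ge_1[of k]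
    by (intro mult_left_mono) auto
  then show ?thesis
    by simp
qed

text \<open>Both windows keep distance at least \<open>\<Lambda> * real k - 1\<close> from the outer
  centres, and the central bump is at most 1. The second assumption, which
  \<open>eventually_height\<close> provides for large \<open>k\<close>, turns this into a quarter of
  the bound in \<open>trial_weighted_ge\<close>.\<close>

lemma trial_weighted_le:
  assumes "2 \<le> \<Lambda> * real k"
    and "1 + 2 * height k * exp (- \<kappa> * (\<Lambda> * real k - 1)\<^sup>2) \<le> height k * exp (- \<kappa>) / 4"
    and "x \<in> {0..1} \<or> x \<in> {2 * (\<Lambda> * real k)..2 * (\<Lambda> * real k) + 1}"
  shows "trial k x * root_weight x \<le> amp * height k * exp (- \<kappa>) / bumps_norm k / 4"
proof -
  define X where "X = \<Lambda> * real k"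
  have "2 \<le> X" "x \<in> {0..1} \<or> x \<in> {2 * X..2 * X + 1}"
    using assms(1,3) by (simp_all only: X_def)
  then have "\<bar>X - 1\<bar> \<le> \<bar>x - X\<bar>" "\<bar>X - 1\<bar> \<le> \<bar>x + X\<bar>"
    by auto
  then have "exp (- \<kappa> * (x - X)\<^sup>2) \<le> exp (- \<kappa> * (X - 1)\<^sup>2)"
    "exp (- \<kappa> * (x + X)\<^sup>2) \<le> exp (- \<kappa> * (X - 1)\<^sup>2)" "exp (- \<kappa> * x\<^sup>2) \<le> 1"
    using constants_pos by (auto simp: abs_le_square_iff)
  then have "exp (- \<kappa> * x\<^sup>2) + height k * (exp (- \<kappa> * (x - X)\<^sup>2) + exp (- \<kappa> * (x + X)\<^sup>2))
      \<le> 1 + height k * (exp (- \<kappa> * (X - 1)\<^sup>2) + exp (- \<kappa> * (X - 1)\<^sup>2))"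
    using constants_pos(5)[of k] by (intro add_mono mult_left_mono) auto
  also have "\<dots> \<le> height k * exp (- \<kappa>) / 4"
    using assms(2) by (simp add: X_def mult_ac)
  finally have "trial k x * root_weight x \<le> amp / bumps_norm k * (height k * exp (- \<kappa>) / 4)"
    unfolding trial_weighted X_def using constants_pos bumps_norm_ge_1[of k]
    by (intro mult_left_mono) auto
  then show ?thesis
    by simp
qed

section \<open>Distance from the trial functions to the Gaussians\<close>

lemma gauss_weighted:
  assumes "0 < a"
  shows "gauss a r x * root_weight x = exp ((pi * \<theta> / p - a) * x\<^sup>2 + 2 * a * r * x
    + (ln ((2 * a / pi) powr (1 / 4) * 2 powr (- \<theta> / (4 * p))) - a * r\<^sup>2))"
proof -
  define B where "B = (2 * a / pi) powr (1 / 4) * 2 powr (- \<theta> / (4 * p))"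
  have B: "0 < B"
    using assms by (simp add: B_def)
  have "gauss a r x * root_weight x = B * (exp (- a * (x - r)\<^sup>2) * exp (pi * \<theta> / p * x\<^sup>2))"
    by (simp add: gauss_def root_weight_eq B_def)
  also have "\<dots> = exp (ln B + (- a * (x - r)\<^sup>2 + pi * \<theta> / p * x\<^sup>2))"
    using B by (simp only: exp_add exp_ln)
  also have "ln B + (- a * (x - r)\<^sup>2 + pi * \<theta> / p * x\<^sup>2)
      = (pi * \<theta> / p - a) * x\<^sup>2 + 2 * a * r * x + (ln B - a * r\<^sup>2)"
    by (simp add: power2_diff algebra_simps)
  finally show ?thesis
    unfolding B_def .
qed

text \<open>The quadratic exponent in \<open>gauss_weighted\<close> may have a leading coefficient
  of either sign; Gaussians of infinite weighted norm need no separate treatment. The weighted trial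
  function is at least \<open>4 * t\<close> at the outer bumps and at most \<open>t\<close> on the
  two gap windows, so a Gaussian on the wrong side of the level \<open>2 * t\<close> throughout one
  window is off by at least \<open>t\<close>.\<close>

lemma Lp_norm_trial_minus_gauss_ge:
  assumes "2 \<le> \<Lambda> * real k"
    and "1 + 2 * height k * exp (- \<kappa> * (\<Lambda> * real k - 1)\<^sup>2) \<le> height k * exp (- \<kappa>) / 4"
    and "0 < a"
  shows "ennreal (amp * height k * exp (- \<kappa>) / bumps_norm k / 4)
    \<le> Lp_norm p (m_theta \<theta>) (\<lambda>x. trial k x - gauss a r x)"
proof -
  define t where "t = amp * height k * exp (- \<kappa>) / bumps_norm k / 4"
  define X where "X = \<Lambda> * real k"
  define U where "U x = gauss a r x * root_weight x" for x
  have X: "2 \<le> X"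
    using assms(1) by (simp add: X_def)
  have t: "0 < t"
    using constants_pos bumps_norm_ge_1[of k] by (simp add: t_def)
  \<comment> \<open>Intervals such as \<open>{0..0 + 1}\<close> are kept unsimplified here and below
    to match the form \<open>{w..w + 1}\<close> in \<open>window\<close>.\<close>
  have ge: "4 * t \<le> trial k x * root_weight x" if "x \<in> {X..X + 1} \<or> x \<in> {- X - 1..- X - 1 + 1}" for x
    using trial_weighted_ge[of x k] that by (simp add: t_def X_def)
  have le: "trial k x * root_weight x \<le> t" if "x \<in> {0..0 + 1} \<or> x \<in> {2 * X..2 * X + 1}" for x
    using trial_weighted_le[OF assms(1,2), of x] that by (simp add: t_def X_def)
  have meas: "(\<lambda>x. trial k x - gauss a r x) \<in> borel_measurable borel"
    unfolding gauss_def by measurable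
  have eq: "\<bar>trial k x - gauss a r x\<bar> * root_weight x = \<bar>trial k x * root_weight x - U x\<bar>" for x
    using root_weight_pos[of x] by (simp add: U_def abs_mult flip: left_diff_distrib)
  have window: ?thesis if "\<And>x. x \<in> {w..w + 1} \<Longrightarrow> t \<le> \<bar>trial k x * root_weight x - U x\<bar>" for w
    unfolding t_def[symmetric]
    by (rule Lp_norm_m_theta_ge[OF meas, where w = w]) (use t that eq in auto)
  have U: "2 * t \<le> U y \<or> 2 * t \<le> U z"
    if "x\<^sub>1 < y" "y < x\<^sub>2" "x\<^sub>2 < z" "2 * t \<le> U x\<^sub>1" "2 * t \<le> U x\<^sub>2" for x\<^sub>1 y x\<^sub>2 z
  proof -
    obtain \<alpha> \<beta> \<gamma> where "\<And>x. U x = exp (\<alpha> * x\<^sup>2 + \<beta> * x + \<gamma>)"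
      unfolding U_def using gauss_weighted[OF assms(3)] by blast
    then have "2 * t \<le> U x \<longleftrightarrow> ln (2 * t) \<le> \<alpha> * x\<^sup>2 + \<beta> * x + \<gamma>" for x
      using t by (metis exp_le_cancel_iff exp_ln mult_pos_pos zero_less_numeral)
    then show ?thesis
      using quadratic_superlevel[OF that(1-3)] that(4,5) by simp
  qed
  \<comment> \<open>Either the Gaussian is too small on a whole window at one bump, or it reaches
    the level at some point of each.\<close>
  consider "\<forall>x\<in>{- X - 1..- X - 1 + 1}. U x < 2 * t" | "\<forall>x\<in>{X..X + 1}. U x < 2 * t"
    | x\<^sub>1 x\<^sub>2 where "x\<^sub>1 \<in> {- X - 1..- X - 1 + 1}" "x\<^sub>2 \<in> {X..X + 1}" "2 * t \<le> U x\<^sub>1" "2 * t \<le> U x\<^sub>2"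
    by (meson not_less)
  then show ?thesis
  proof cases
    case 1
    show ?thesis
      by (rule window[of "- X - 1"]) (use 1 ge t in fastforce)
  next
    case 2
    show ?thesis
      by (rule window[of X]) (use 2 ge t in fastforce)
  next
    case 3
    \<comment> \<open>The bound \<open>2 \<le> X\<close> makes the windows at
      \<open>- X - 1\<close>, \<open>0\<close>, \<open>X\<close> and \<open>2 * X\<close> disjoint
      and ordered. Since the disjunction holds for every pair of \<open>y\<close> and
      \<open>z\<close>, one alternative holds on its entire window.\<close>
    have "2 * t \<le> U y \<or> 2 * t \<le> U z" if "y \<in> {0..0 + 1}" "z \<in> {2 * X..2 * X + 1}" for y z
      by (rule U[OF _ _ _ 3(3,4)]) (use 3(1,2) that X in auto)
    then consider "\<forall>y\<in>{0..0 + 1}. 2 * t \<le> U y" | "\<forall>z\<in>{2 * X..2 * X + 1}. 2 * t \<le> U z"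
      by blast
    then show ?thesis
    proof cases
      case 1
      show ?thesis
        by (rule window[of 0]) (use 1 le t in fastforce)
    next
      case 2
      show ?thesis
        by (rule window[of "2 * X"]) (use 2 le t in fastforce)
    qed
  qed
qed

section \<open>Asymptotics of the weighted norm and of the ratio\<close>

lemma height_at_top: "filterlim height at_top sequentially"
  unfolding height_def[abs_def] using constants_pos(2) by real_asymp

lemma eventually_height:
  "\<forall>\<^sub>F k in sequentially.
    1 + 2 * height k * exp (- \<kappa> * (\<Lambda> * real k - 1)\<^sup>2) \<le> height k * exp (- \<kappa>) / 4"
proof -
  have 1: "(\<lambda>k. inverse (height k)) \<longlonglongrightarrow> 0"
    by (rule tendsto_inverse_0_at_top[OF height_at_top])
  have 2: "(\<lambda>k. exp (- \<kappa> * (\<Lambda> * real k - 1)\<^sup>2)) \<longlonglongrightarrow> 0"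
    using constants_pos(1,3) by real_asymp
  \<comment> \<open>After division by \<open>height k\<close> the left side of the claim is a null
    sequence, while the right side is a positive constant.\<close>
  have "(\<lambda>k. inverse (height k) + 2 * exp (- \<kappa> * (\<Lambda> * real k - 1)\<^sup>2)) \<longlonglongrightarrow> 0 + 2 * 0"
    by (intro tendsto_intros 1 2)
  then have "\<forall>\<^sub>F k in sequentially. inverse (height k) + 2 * exp (- \<kappa> * (\<Lambda> * real k - 1)\<^sup>2) < exp (- \<kappa>) / 4"
    by (rule order_tendstoD) simp
  then show ?thesis
  proof eventually_elim
    case (elim k)
    then have "height k * (inverse (height k) + 2 * exp (- \<kappa> * (\<Lambda> * real k - 1)\<^sup>2))
        \<le> height k * (exp (- \<kappa>) / 4)"
      using constants_pos(5)[of k] by (intro mult_left_mono) auto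
    moreover have "height k * inverse (height k) = 1"
      using constants_pos(5)[of k] by simp
    ultimately show ?case
      unfolding distrib_left by (simp add: mult_ac)
  qed
qed

lemma eventually_bumps_norm_le: "\<forall>\<^sub>F k in sequentially. bumps_norm k \<le> 2"
  using order_tendstoD(2)[OF bumps_norm_tendsto, of 2] by (auto elim: eventually_mono)

lemma divide_bumps_norm_ge: "bumps_norm k \<le> 2 \<Longrightarrow> 0 \<le> y \<Longrightarrow> y / 2 \<le> y / bumps_norm k"
  using bumps_norm_ge_1[of k] by (intro divide_left_mono) auto

text \<open>The unit window at the right bump alone forces growth of order \<open>height k\<close>;
  the factor 1/2 absorbs \<open>bumps_norm k \<le> 2\<close>.\<close>

lemma Lp_norm_trial_tendsto: "(\<lambda>k. Lp_norm p (m_theta \<theta>) (trial k)) \<longlonglongrightarrow> \<infinity>"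
proof (rule tendsto_sandwich[OF _ _ _ tendsto_const])
  have "filterlim (\<lambda>k. amp * exp (- \<kappa>) / 2 * height k) at_top sequentially"
    using constants_pos by (intro filterlim_tendsto_pos_mult_at_top[OF tendsto_const _ height_at_top]) simp
  then show "(\<lambda>k. ennreal (amp * exp (- \<kappa>) / 2 * height k)) \<longlonglongrightarrow> \<infinity>"
    by (simp add: ennreal_tendsto_top_eq_at_top)
  show "\<forall>\<^sub>F k in sequentially. ennreal (amp * exp (- \<kappa>) / 2 * height k) \<le> Lp_norm p (m_theta \<theta>) (trial k)"
    using eventually_bumps_norm_le
  proof eventually_elim
    case (elim k)
    have "0 \<le> amp * height k * exp (- \<kappa>)"
      using constants_pos by (simp add: less_imp_le)
    note * = divide_bumps_norm_ge[OF elim this]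
    show ?case
    proof (rule Lp_norm_m_theta_ge)
      fix x
      assume "x \<in> {\<Lambda> * real k..\<Lambda> * real k + 1}"
      from order_trans[OF * trial_weighted_ge[OF disjI1[OF this]]]
      show "amp * exp (- \<kappa>) / 2 * height k \<le> \<bar>trial k x\<bar> * root_weight x"
        using trial_nonneg[of k x] by (simp add: mult_ac)
    qed (use constants_pos in \<open>auto simp: less_imp_le\<close>)
  qed
qed simp

text \<open>The 8 combines the 4 of \<open>Lp_norm_trial_minus_gauss_ge\<close> with the eventual
  bound 2 on \<open>bumps_norm\<close>; the divisor is the constant of
  \<open>Lp_norm_trial_le\<close>. Once \<open>1 \<le> height k\<close>, numerator and denominator
  are both multiples of \<open>height k\<close>, which cancels.\<close>

lemma eventually_dist_ratio_ge:
  "\<forall>\<^sub>F k in sequentially.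
    ennreal (amp * exp (- \<kappa>) / 8 / (3 * amp * (3 * sqrt (pi / (\<kappa> * p))) powr (1 / p)))
    \<le> Lp_dist p (m_theta \<theta>) (trial k) gaussians / Lp_norm p (m_theta \<theta>) (trial k)"
proof -
  define K where "K = 3 * amp * (3 * sqrt (pi / (\<kappa> * p))) powr (1 / p)"
  have K: "0 < K"
    using constants_pos \<theta> by (simp add: K_def)
  have "\<forall>\<^sub>F k in sequentially. 2 \<le> \<Lambda> * real k"
    using constants_pos(3) by real_asymp
  moreover have "\<forall>\<^sub>F k in sequentially. 1 \<le> height k"
    using height_at_top by (simp add: filterlim_at_top)
  ultimately have "\<forall>\<^sub>F k in sequentially. ennreal (amp * exp (- \<kappa>) / 8 / K)
    \<le> Lp_dist p (m_theta \<theta>) (trial k) gaussians / Lp_norm p (m_theta \<theta>) (trial k)"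
    using eventually_height eventually_bumps_norm_le
  proof eventually_elim
    case (elim k)
    have "0 \<le> amp * height k * exp (- \<kappa>)"
      using constants_pos by (simp add: less_imp_le)
    from divide_bumps_norm_ge[OF elim(4) this]
    have "ennreal (amp * height k * exp (- \<kappa>) / 8) \<le> ennreal (amp * height k * exp (- \<kappa>) / bumps_norm k / 4)"
      by (intro ennreal_leI) (simp add: mult_ac)
    also have "\<dots> \<le> Lp_dist p (m_theta \<theta>) (trial k) gaussians"
      unfolding Lp_dist_def
    proof (rule INF_greatest)
      fix u
      assume "u \<in> gaussians"
      then obtain a r where "u = gauss a r" "0 < a"
        by (auto simp: gaussians_def)
      then show "ennreal (amp * height k * exp (- \<kappa>) / bumps_norm k / 4)
          \<le> Lp_norm p (m_theta \<theta>) (\<lambda>x. trial k x - u x)"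
        using Lp_norm_trial_minus_gauss_ge[OF elim(1,3)] by simp
    qed
    finally have dist: "ennreal (amp * height k * exp (- \<kappa>) / 8) \<le> Lp_dist p (m_theta \<theta>) (trial k) gaussians" .
    have norm: "Lp_norm p (m_theta \<theta>) (trial k) \<le> ennreal (K * height k)"
      using Lp_norm_trial_le[of k] elim(2) by (simp add: K_def)
    have "ennreal (amp * exp (- \<kappa>) / 8 / K) = ennreal ((amp * height k * exp (- \<kappa>) / 8) / (K * height k))"
      using constants_pos(5)[of k] by simp
    also have "\<dots> = ennreal (amp * height k * exp (- \<kappa>) / 8) / ennreal (K * height k)"
      using K constants_pos by (intro divide_ennreal[symmetric]) (auto simp: less_imp_le)
    also have "\<dots> \<le> Lp_dist p (m_theta \<theta>) (trial k) gaussians / Lp_norm p (m_theta \<theta>) (trial k)"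
      unfolding divide_ennreal_def by (intro mult_mono dist ennreal_inverse_antimono norm) auto
    finally show ?case .
  qed
  then show ?thesis
    by (simp add: K_def)
qed

end

theorem theorem1p12:
  fixes p \<theta> :: real
  assumes "0 < \<theta>" and "\<theta> < p"
  shows "\<exists>C::real. 0 < C \<and>
    (\<exists>h :: nat \<Rightarrow> real \<Rightarrow> real.
      (\<forall>k x. 0 \<le> h k x) \<and>
      (\<forall>k. h k \<in> Lp p (m_theta \<theta>)) \<and>
      (\<forall>k. Lp_norm 2 lborel (h k) = 1) \<and>
      (\<lambda>k. delta_BH (h k)) \<longlonglongrightarrow> 0 \<and>
      (\<lambda>k. Lp_norm p (m_theta \<theta>) (h k)) \<longlonglongrightarrow> \<infinity> \<and>
      liminf (\<lambda>k. Lp_dist p (m_theta \<theta>) (h k) gaussians / Lp_norm p (m_theta \<theta>) (h k))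
        \<ge> ennreal C)"
proof -
  let ?A = "amp p \<theta>" and ?\<kappa> = "\<kappa> p \<theta>"
  \<comment> \<open>This is the bound of \<open>eventually_dist_ratio_ge\<close>; it is built from
    \<open>p\<close> and \<open>\<theta>\<close> alone.\<close>
  let ?C = "?A * exp (- ?\<kappa>) / 8 / (3 * ?A * (3 * sqrt (pi / (?\<kappa> * p))) powr (1 / p))"
  have "0 < ?C"
    using constants_pos[OF assms] assms by simp
  moreover note trial_nonneg trial_in_Lp[OF assms] Lp_norm_2_trial delta_BH_trial_tendsto
    Lp_norm_trial_tendsto[OF assms] Liminf_bounded[OF eventually_dist_ratio_ge[OF assms]]
  ultimately show ?thesis
    by blast
qed

end
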